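(* Let $\{a_i(n)\}_{n\geq 0}$ and $\{b_i(n)\}_{n\geq 0}$ be $2$-automatic integer sequences for $i=0,1$. Let $\mathbf{u}=\{u(n)\}_{n\geq 0}$ be an integer sequence satisfying, for all $n\geq 0$, $$u(2n)=a_0(n)u(n)+b_0(n),\qquad u(2n+1)=a_1(n)u(n+1)+b_1(n).$$ Then the sequence $\mathbf{u}$ is $2$-regular.
   Context: The $2$-kernel of a sequence $\mathbf{u}=\{u(n)\}_{n\geq 0}$ is the set of subsequences $\{\{u(2^i n+j)\}_{n\geq 0}: i\geq 0,\ 0\leq j<2^i\}$. A sequence taking values in a finite set is $2$-automatic if its $2$-kernel is a finite set. An integer sequence is $2$-regular (over $\mathbb{Z}$) if there exist finitely many integer sequences such that every element of its $2$-kernel is a $\mathbb{Z}$-linear combination of them. *)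

theory Defs
  imports Main
begin

definition two_kernel :: "(nat \<Rightarrow> 'a) \<Rightarrow> (nat \<Rightarrow> 'a) set" where
  "two_kernel u = {(\<lambda>n. u (2 ^ i * n + j)) | i j. j < 2 ^ i}"

definition two_automatic :: "(nat \<Rightarrow> 'a) \<Rightarrow> bool" where
  "two_automatic u \<longleftrightarrow> finite (range u) \<and> finite (two_kernel u)"

definition two_regular :: "(nat \<Rightarrow> int) \<Rightarrow> bool" where
  "two_regular u \<longleftrightarrow>
     (\<exists>S :: (nat \<Rightarrow> int) set. finite S \<and>
       (\<forall>v \<in> two_kernel u. \<exists>c :: (nat \<Rightarrow> int) \<Rightarrow> int. \<forall>n. v n = (\<Sum>s\<in>S. c s * s n)))"

end

theory Submission
  imports Defs "HOL-Library.FuncSet"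
begin

text \<open>
  Record in a colour \<open>F n\<close> the values at \<open>n\<close> and \<open>n + 1\<close> of all sequences in the 2-kernels of
  \<open>a\<^sub>0, a\<^sub>1, b\<^sub>0, b\<^sub>1\<close>; only finitely many colours occur. Unfolding the recurrence \<open>i\<close> times
  expresses \<open>u (2 ^ i * n + j)\<close> as a combination of \<open>u n\<close>, \<open>u (n + 1)\<close> and \<open>1\<close> whose coefficients
  depend on \<open>n\<close> only through \<open>F n\<close>. These coefficients may be unbounded in \<open>i\<close>, but each is a
  \<open>\<int>\<close>-combination of the finitely many indicator functions of colour classes, so the products
  of these indicators with \<open>u n\<close>, \<open>u (n + 1)\<close> and \<open>1\<close> generate the whole 2-kernel.
\<close>

lemma two_kernelI: "j < 2 ^ i \<Longrightarrow> (\<lambda>n. u (2 ^ i * n + j)) \<in> two_kernel u"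
  unfolding two_kernel_def by blast

lemma finite_range_two_kernel:
  assumes "finite (range u)" and "f \<in> two_kernel u"
  shows "finite (range f)"
  by (rule finite_subset[OF _ assms(1)]) (use assms(2) in \<open>auto simp: two_kernel_def\<close>)

text \<open>The generators arise as an indexed family, but \<open>two_regular\<close> asks for a
  set; indices with the same sequence \<open>g i\<close> are merged by adding their
  coefficients.\<close>

lemma sum_over_image:
  fixes g :: "'i \<Rightarrow> nat \<Rightarrow> int"
  assumes "finite I"
  shows "\<exists>c. \<forall>n. (\<Sum>i\<in>I. d i * g i n) = (\<Sum>s\<in>g ` I. c s * s n)"
proof (intro exI allI)
  fix n
  have "(\<Sum>i\<in>I. d i * g i n) = (\<Sum>s\<in>g ` I. \<Sum>i\<in>{i \<in> I. g i = s}. d i * g i n)"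
    using assms by (rule sum.image_gen)
  also have "\<dots> = (\<Sum>s\<in>g ` I. (\<Sum>i\<in>{i \<in> I. g i = s}. d i) * s n)"
    by (auto simp: sum_distrib_right intro!: sum.cong)
  finally show "(\<Sum>i\<in>I. d i * g i n) = (\<Sum>s\<in>g ` I. (\<Sum>i\<in>{i \<in> I. g i = s}. d i) * s n)" .
qed

text \<open>\<open>P (F n) k\<close> is the sum of \<open>P c k * of_bool (F n = c)\<close> over all
  colours \<open>c\<close>. Only the integers \<open>P c k\<close> vary with \<open>v\<close>; the
  generators \<open>?g\<close> do not.\<close>

lemma two_regular_if_finite_colouring:
  fixes F :: "nat \<Rightarrow> 'c" and w :: "'k \<Rightarrow> nat \<Rightarrow> int"
  assumes "finite (range F)" and "finite T"
    and coeffs: "\<And>v. v \<in> two_kernel u \<Longrightarrow> \<exists>P. \<forall>n. v n = (\<Sum>k\<in>T. P (F n) k * w k n)"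
  shows "two_regular u"
proof -
  let ?g = "\<lambda>(c, k) n. of_bool (F n = c) * w k n"
  let ?I = "range F \<times> T"
  have fin: "finite ?I" using assms(1,2) by simp
  have "\<exists>c. \<forall>n. v n = (\<Sum>s\<in>?g ` ?I. c s * s n)" if v: "v \<in> two_kernel u" for v
  proof -
    obtain P where P: "\<And>n. v n = (\<Sum>k\<in>T. P (F n) k * w k n)"
      using coeffs[OF v] by blast
    have "v n = (\<Sum>i\<in>?I. case_prod P i * ?g i n)" for n
    proof -
      have "(\<Sum>i\<in>?I. case_prod P i * ?g i n) =
          (\<Sum>c\<in>range F. \<Sum>k\<in>T. P c k * (of_bool (F n = c) * w k n))"
        by (simp add: sum.cartesian_product case_prod_unfold)
      also have "\<dots> = (\<Sum>c\<in>range F. if F n = c then v n else 0)"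
        by (rule sum.cong) (auto simp: P)
      also have "\<dots> = v n"
        using assms(1) by simp
      finally show ?thesis by simp
    qed
    then show ?thesis using sum_over_image[OF fin, of "case_prod P" ?g] by simp
  qed
  then show ?thesis unfolding two_regular_def using fin by blast
qed

text \<open>Restricting to \<open>K\<close> fixes the value elsewhere, so colours lie in a
  \<open>PiE\<close> product, finite when \<open>K\<close> and the ranges are.\<close>

definition colour :: "(nat \<Rightarrow> 'a) set \<Rightarrow> nat \<Rightarrow> (nat \<Rightarrow> 'a) \<Rightarrow> 'a \<times> 'a" where
  "colour K n = (\<lambda>f\<in>K. (f n, f (Suc n)))"

lemma finite_range_colour:
  assumes "finite K" and "\<And>f. f \<in> K \<Longrightarrow> finite (range f)"
  shows "finite (range (colour K))"
proof (rule finite_subset)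
  show "range (colour K) \<subseteq> (\<Pi>\<^sub>E f\<in>K. range f \<times> range f)"
    by (auto simp: colour_def)
  show "finite (\<Pi>\<^sub>E f\<in>K. range f \<times> range f)"
    using assms by (intro finite_PiE) auto
qed

text \<open>The case \<open>j = 2 ^ i\<close> arises from carries; it is the reason why colours also look at \<open>n + 1\<close>.\<close>

lemma kernel_factors_colour:
  assumes K: "two_kernel a \<subseteq> K" and j: "j \<le> 2 ^ i"
  shows "\<exists>g. \<forall>n. a (2 ^ i * n + j) = g (colour K n)"
proof (cases "j = 2 ^ i")
  case True
  let ?f = "\<lambda>n. a (2 ^ i * n + 0)"
  have "?f \<in> K" using K two_kernelI[of 0 i a] by auto
  then have "\<forall>n. a (2 ^ i * n + j) = snd (colour K n ?f)"
    using True by (simp add: colour_def add.commute)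
  then show ?thesis by (rule exI[of _ "\<lambda>c. snd (c ?f)"])
next
  case False
  let ?f = "\<lambda>n. a (2 ^ i * n + j)"
  have "?f \<in> K" using K two_kernelI[of j i a] False j by auto
  then have "\<forall>n. a (2 ^ i * n + j) = fst (colour K n ?f)"
    by (simp add: colour_def)
  then show ?thesis by (rule exI[of _ "\<lambda>c. fst (c ?f)"])
qed

text \<open>Induction on \<open>i\<close>, removing the lowest binary digit of \<open>j\<close>. The
  bound is not strict because the odd recurrence passes to \<open>k + 1\<close>, which may equal
  \<open>2 ^ i\<close>.\<close>

lemma iterated_recurrence:
  fixes a\<^sub>0 a\<^sub>1 b\<^sub>0 b\<^sub>1 u :: "nat \<Rightarrow> int"
  assumes K: "two_kernel a\<^sub>0 \<subseteq> K" "two_kernel a\<^sub>1 \<subseteq> K" "two_kernel b\<^sub>0 \<subseteq> K" "two_kernel b\<^sub>1 \<subseteq> K"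
    and even_rec: "\<And>n. u (2 * n) = a\<^sub>0 n * u n + b\<^sub>0 n"
    and odd_rec: "\<And>n. u (2 * n + 1) = a\<^sub>1 n * u (n + 1) + b\<^sub>1 n"
    and "j \<le> 2 ^ i"
  shows "\<exists>P Q R. \<forall>n. u (2 ^ i * n + j) =
    P (colour K n) * u n + Q (colour K n) * u (Suc n) + R (colour K n)"
  using \<open>j \<le> 2 ^ i\<close>
proof (induction i arbitrary: j)
  case 0
  show ?case
  proof (cases "j = 0")
    case True
    then show ?thesis
      by (intro exI[of _ "\<lambda>_. 1"] exI[of _ "\<lambda>_. 0"]) simp
  next
    case False
    with 0 have "j = 1" by simp
    then show ?thesis
      by (intro exI[of _ "\<lambda>_. 0"] exI[of _ "\<lambda>_. 1"]) (simp add: exI[of _ "\<lambda>_. 0"])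
  qed
next
  case (Suc i)
  \<comment> \<open>Shared by both parities: \<open>l = k\<close> for even \<open>j\<close>,
    \<open>l = k + 1\<close> for odd \<open>j\<close>.\<close>
  have step: ?case
    if a: "two_kernel a \<subseteq> K" and b: "two_kernel b \<subseteq> K" and k: "k \<le> 2 ^ i" and l: "l \<le> 2 ^ i"
      and eq: "\<And>n. u (2 ^ Suc i * n + j) = a (2 ^ i * n + k) * u (2 ^ i * n + l) + b (2 ^ i * n + k)"
    for a b k l
  proof -
    obtain g where g: "\<And>n. a (2 ^ i * n + k) = g (colour K n)"
      using kernel_factors_colour[OF a k] by blast
    obtain h where h: "\<And>n. b (2 ^ i * n + k) = h (colour K n)"
      using kernel_factors_colour[OF b k] by blast
    obtain P Q R where PQR: "\<And>n. u (2 ^ i * n + l) =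
        P (colour K n) * u n + Q (colour K n) * u (Suc n) + R (colour K n)"
      using Suc.IH[OF l] by blast
    show ?thesis
      apply (rule exI[of _ "\<lambda>c. g c * P c"], rule exI[of _ "\<lambda>c. g c * Q c"])
      apply (rule exI[of _ "\<lambda>c. g c * R c + h c"])
      apply (simp only: eq g h PQR)
      apply (simp add: algebra_simps)
      done
  qed
  show ?case
  proof (cases "even j")
    case True
    then obtain k where k: "j = 2 * k" by blast
    show ?thesis
    proof (rule step[OF K(1,3)])
      show "k \<le> 2 ^ i" "k \<le> 2 ^ i" using Suc.prems k by auto
      show "u (2 ^ Suc i * n + j) = a\<^sub>0 (2 ^ i * n + k) * u (2 ^ i * n + k) + b\<^sub>0 (2 ^ i * n + k)" for n
        using even_rec[of "2 ^ i * n + k"] k by (simp add: algebra_simps)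
    qed
  next
    case False
    then obtain k where k: "j = 2 * k + 1" by (rule oddE)
    show ?thesis
    proof (rule step[OF K(2,4)])
      \<comment> \<open>As \<open>2 ^ Suc i\<close> is even, the odd \<open>j\<close> lies strictly
        below it, which leaves room for \<open>k + 1\<close>.\<close>
      show "k \<le> 2 ^ i" "k + 1 \<le> 2 ^ i" using Suc.prems k by auto
      show "u (2 ^ Suc i * n + j) =
          a\<^sub>1 (2 ^ i * n + k) * u (2 ^ i * n + (k + 1)) + b\<^sub>1 (2 ^ i * n + k)" for n
        using odd_rec[of "2 ^ i * n + k"] k by (simp add: algebra_simps)
    qed
  qed
qed

theorem corollary1:
  fixes a\<^sub>0 a\<^sub>1 b\<^sub>0 b\<^sub>1 u :: "nat \<Rightarrow> int"
  assumes "two_automatic a\<^sub>0" and "two_automatic a\<^sub>1"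
    and "two_automatic b\<^sub>0" and "two_automatic b\<^sub>1"
    and "\<And>n. u (2 * n) = a\<^sub>0 n * u n + b\<^sub>0 n"
    and "\<And>n. u (2 * n + 1) = a\<^sub>1 n * u (n + 1) + b\<^sub>1 n"
  shows "two_regular u"
proof -
  define K where "K = two_kernel a\<^sub>0 \<union> two_kernel a\<^sub>1 \<union> two_kernel b\<^sub>0 \<union> two_kernel b\<^sub>1"
  \<comment> \<open>The constant entry carries the inhomogeneous part \<open>R\<close>.\<close>
  let ?w = "\<lambda>k n. [u n, u (Suc n), 1] ! k"
  show ?thesis
  proof (rule two_regular_if_finite_colouring)
    show "finite (range (colour K))"
      using assms(1-4)
      by (intro finite_range_colour) (auto simp: K_def two_automatic_def intro: finite_range_two_kernel)
    show "finite {..<3::nat}" by simp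
    fix v assume "v \<in> two_kernel u"
    then obtain i j where "j < 2 ^ i" and v: "v = (\<lambda>n. u (2 ^ i * n + j))"
      unfolding two_kernel_def by blast
    then have "\<exists>P Q R. \<forall>n. v n =
        P (colour K n) * u n + Q (colour K n) * u (Suc n) + R (colour K n)"
      unfolding v by (intro iterated_recurrence[OF _ _ _ _ assms(5,6)]) (auto simp: K_def)
    then obtain P Q R where PQR: "\<And>n. v n =
        P (colour K n) * u n + Q (colour K n) * u (Suc n) + R (colour K n)"
      by blast
    show "\<exists>P. \<forall>n. v n = (\<Sum>k\<in>{..<3::nat}. P (colour K n) k * ?w k n)"
      by (intro exI[of _ "\<lambda>c k. [P c, Q c, R c] ! k"]) (simp add: PQR numeral_3_eq_3)
  qed
qed

end
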